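(* Let $C_1$, $C_2$, and $C'_2$ be clones on $\{0,1\}$. Suppose that $C_2$ and $C'_2$ both belong to one and the same of the following intervals of the lattice of clones on $\{0,1\}$: $[J, I]$, $[I^*, \Omega(1)]$, $[V_{01}, V]$, $[\Lambda_{01}, \Lambda]$, $[MU^k_{01}, MU^k]$ for some $k \in \{2,3,\dots,\infty\}$, $[MW^k_{01}, MW^k]$ for some $k \in \{2,3,\dots,\infty\}$, $[M_{01}, M]$. Then the lattices $\mathcal{L}_{(C_1,C_2)}$ and $\mathcal{L}_{(C_1,C'_2)}$ are either both finite, or both countably infinite, or both uncountable.
   Context: A Boolean function is a map $f \colon \{0,1\}^n \to \{0,1\}$ for some integer $n \geq 1$ (its arity). If $f$ is $n$-ary and $g_1,\dots,g_n$ are $m$-ary, then $f(g_1,\dots,g_n)$ is the $m$-ary function $\mathbf{a} \mapsto f(g_1(\mathbf{a}),\dots,g_n(\mathbf{a}))$. For sets $F, G$ of Boolean functions, $FG$ is the set of all composites $f(g_1,\dots,g_n)$ with $f \in F$ of some arity $n$ and $g_1,\dots,g_n \in G$ all of a common arity. A clone on $\{0,1\}$ is a set $C$ of Boolean functions containing all projections and satisfying $CC \subseteq C$. For clones $C_1,C_2$ on $\{0,1\}$, a (possibly empty) set $K$ of Boolean functions is a $(C_1,C_2)$-clonoid if $KC_1 \subseteq K$ and $C_2K \subseteq K$; $\mathcal{L}_{(C_1,C_2)}$ is the lattice (under inclusion) of all $(C_1,C_2)$-clonoids. For clones $K \subseteq K'$, $[K,K']$ is the set of clones $C$ on $\{0,1\}$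 with $K \subseteq C \subseteq K'$. For a set $K$ of Boolean functions, $K_{01} = \{f \in K : f(0,\dots,0)=0,\ f(1,\dots,1)=1\}$. $J$ is the clone of all projections; $I$ the clone of all projections and constant functions; $I^*$ the clone of all projections and negated projections; $\Omega(1)$ the clone of all projections, negated projections, and constant functions; $V$ (resp. $\Lambda$) the clone generated by $\vee$ (resp. $\wedge$) and the constants $0,1$; $M$ the clone of monotone functions. $U^k$ is the clone of all $f$ such that $\bigwedge T \neq (0,\dots,0)$ for every $T \subseteq f^{-1}(1)$ with $|T| \leq k$; $W^k$ is the clone of all $f$ such that $\bigvee F \neq (1,\dots,1)$ for every $F \subseteq f^{-1}(0)$ with $|F| \leq k$ (componentwise meets and joins, empty meet $=(1,\dots,1)$, empty join $=(0,\dots,0)$; no cardinality restriction for $k=\infty$). $MU^k = M \cap U^k$, $MW^k = M \cap W^k$. *)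

theory Defs
  imports Main "HOL-Library.FuncSet" "HOL-Library.Countable_Set" "HOL-Library.Extended_Nat"
begin

definition cube :: "nat \<Rightarrow> bool list set" where
  "cube n = {a. length a = n}"

text \<open>
  A Boolean function is a pair of its arity and its map on the cube. Maps are extensional,
  so that equality of pairs is equality of Boolean functions.
\<close>
type_synonym bfun = "nat \<times> (bool list \<Rightarrow> bool)"

definition boolean_functions :: "bfun set" where
  "boolean_functions = {(n, f). n \<ge> 1 \<and> f \<in> cube n \<rightarrow>\<^sub>E UNIV}"

definition bfun_compose ::
    "nat \<Rightarrow> (bool list \<Rightarrow> bool) \<Rightarrow> (bool list \<Rightarrow> bool) list \<Rightarrow> bool list \<Rightarrow> bool" where
  "bfun_compose m f gs = (\<lambda>a\<in>cube m. f (map (\<lambda>g. g a) gs))"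

definition set_compose :: "bfun set \<Rightarrow> bfun set \<Rightarrow> bfun set" where
  "set_compose F G =
     {(m, bfun_compose m f gs) | m f gs. (length gs, f) \<in> F \<and> (\<forall>g\<in>set gs. (m, g) \<in> G)}"

definition projections :: "bfun set" where
  "projections = {(n, \<lambda>a\<in>cube n. a ! i) | n i. i < n}"

definition negated_projections :: "bfun set" where
  "negated_projections = {(n, \<lambda>a\<in>cube n. \<not> a ! i) | n i. i < n}"

definition constants :: "bfun set" where
  "constants = {(n, \<lambda>a\<in>cube n. c) | n c. n \<ge> 1}"

definition clone :: "bfun set \<Rightarrow> bool" where
  "clone C \<longleftrightarrow> C \<subseteq> boolean_functions \<and> projections \<subseteq> C \<and> set_compose C C \<subseteq> C"

definition clonoid :: "bfun set \<Rightarrow> bfun set \<Rightarrow> bfun set \<Rightarrow> bool" where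
  "clonoid C1 C2 K \<longleftrightarrow>
     K \<subseteq> boolean_functions \<and> set_compose K C1 \<subseteq> K \<and> set_compose C2 K \<subseteq> K"

definition clonoids :: "bfun set \<Rightarrow> bfun set \<Rightarrow> bfun set set" where
  "clonoids C1 C2 = {K. clonoid C1 C2 K}"

definition clone_interval :: "bfun set \<Rightarrow> bfun set \<Rightarrow> bfun set set" where
  "clone_interval K K' = {C. clone C \<and> K \<subseteq> C \<and> C \<subseteq> K'}"

definition generated_clone :: "bfun set \<Rightarrow> bfun set" where
  "generated_clone F = \<Inter>{C. clone C \<and> F \<subseteq> C}"

definition const_preserving :: "bfun set \<Rightarrow> bfun set" where
  "const_preserving K = {(n, f) \<in> K. \<not> f (replicate n False) \<and> f (replicate n True)}"

definition J_clone :: "bfun set" where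
  "J_clone = projections"

definition I_clone :: "bfun set" where
  "I_clone = projections \<union> constants"

definition Istar_clone :: "bfun set" where
  "Istar_clone = projections \<union> negated_projections"

definition Omega1_clone :: "bfun set" where
  "Omega1_clone = projections \<union> negated_projections \<union> constants"

definition V_clone :: "bfun set" where
  "V_clone = generated_clone (insert (2, \<lambda>a\<in>cube 2. a ! 0 \<or> a ! 1) constants)"

definition Lambda_clone :: "bfun set" where
  "Lambda_clone = generated_clone (insert (2, \<lambda>a\<in>cube 2. a ! 0 \<and> a ! 1) constants)"

definition M_clone :: "bfun set" where
  "M_clone = {(n, f) \<in> boolean_functions.
     \<forall>a\<in>cube n. \<forall>b\<in>cube n. list_all2 (\<le>) a b \<longrightarrow> f a \<le> f b}"

definition cube_meet :: "nat \<Rightarrow> bool list set \<Rightarrow> bool list" where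
  "cube_meet n T = map (\<lambda>i. \<forall>a\<in>T. a ! i) [0..<n]"

definition cube_join :: "nat \<Rightarrow> bool list set \<Rightarrow> bool list" where
  "cube_join n F = map (\<lambda>i. \<exists>a\<in>F. a ! i) [0..<n]"

text \<open>
  Below, \<open>T\<close> and \<open>F\<close> are finite as subsets of the cube, so \<open>card\<close> is their true size and
  \<open>k = \<infinity>\<close> imposes no restriction.
\<close>
definition U_clone :: "enat \<Rightarrow> bfun set" where
  "U_clone k = {(n, f) \<in> boolean_functions.
     \<forall>T. T \<subseteq> {a \<in> cube n. f a} \<and> enat (card T) \<le> k \<longrightarrow> cube_meet n T \<noteq> replicate n False}"

definition W_clone :: "enat \<Rightarrow> bfun set" where
  "W_clone k = {(n, f) \<in> boolean_functions.
     \<forall>F. F \<subseteq> {a \<in> cube n. \<not> f a} \<and> enat (card F) \<le> k \<longrightarrow> cube_join n F \<noteq> replicate n True}"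

definition MU_clone :: "enat \<Rightarrow> bfun set" where
  "MU_clone k = M_clone \<inter> U_clone k"

definition MW_clone :: "enat \<Rightarrow> bfun set" where
  "MW_clone k = M_clone \<inter> W_clone k"

end

theory Submission imports Defs
begin

text \<open>
  In each of the intervals, two clones differ only by constant functions. If
  \<open>C2' \<subseteq> C2 \<union> constants\<close>, then adding the constants of \<open>C2'\<close> to a \<open>(C1, C2)\<close>-clonoid \<open>K\<close> yields a
  \<open>(C1, C2')\<close>-clonoid, since a constant argument of an outer function \<open>f \<in> C2'\<close> can be absorbed
  into \<open>f\<close>. This map has fibres of size at most 4: the nonconstant members of \<open>K\<close> are retained, and
  \<open>K\<close> contains either all or none of the constant functions with a given value. By symmetry, the two
  clonoid lattices are of the same one of the three kinds of size.
\<close>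

section \<open>Composition and constant functions\<close>

lemma projectionI: "i < n \<Longrightarrow> (n, \<lambda>a\<in>cube n. a ! i) \<in> projections"
  unfolding projections_def by blast

lemma constantI: "n \<ge> 1 \<Longrightarrow> (n, \<lambda>a\<in>cube n. c) \<in> constants"
  unfolding constants_def by blast

lemma constantsE:
  assumes "(n, f) \<in> constants"
  obtains c where "n \<ge> 1" "f = (\<lambda>a\<in>cube n. c)"
  using assms unfolding constants_def by blast

lemma set_composeI:
  "(length gs, f) \<in> F \<Longrightarrow> (\<And>g. g \<in> set gs \<Longrightarrow> (m, g) \<in> G) \<Longrightarrow>
    (m, bfun_compose m f gs) \<in> set_compose F G"
  unfolding set_compose_def by blast

lemma set_composeE:
  assumes "x \<in> set_compose F G"
  obtains m f gs where "x = (m, bfun_compose m f gs)" "(length gs, f) \<in> F"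
    "\<And>g. g \<in> set gs \<Longrightarrow> (m, g) \<in> G"
  using assms unfolding set_compose_def by blast

lemma arity_pos: "(n, f) \<in> boolean_functions \<Longrightarrow> n \<ge> 1"
  unfolding boolean_functions_def by simp

lemma replicate_in_cube [simp]: "replicate n c \<in> cube n"
  unfolding cube_def by simp

lemma map_in_cube [simp]: "map h gs \<in> cube (length gs)"
  unfolding cube_def by simp

lemma bfun_compose_const:
  "bfun_compose m (\<lambda>a\<in>cube (length gs). c) gs = (\<lambda>a\<in>cube m. c)"
  unfolding bfun_compose_def by (rule restrict_ext) simp

text \<open>Filling every argument with the first projection of arity \<open>m\<close>, which exists
  because \<open>m \<ge> 1\<close>, keeps the value and changes the arity. Both clones and clonoids
  satisfy the closure condition on \<open>K\<close>.\<close>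

lemma const_change_arity:
  assumes "set_compose K C \<subseteq> K" "projections \<subseteq> C"
    and "(n, \<lambda>a\<in>cube n. c) \<in> K" "m \<ge> 1"
  shows "(m, \<lambda>a\<in>cube m. c) \<in> K"
proof -
  let ?gs = "replicate n (\<lambda>a\<in>cube m. a ! 0)"
  have "(m, bfun_compose m (\<lambda>a\<in>cube (length ?gs). c) ?gs) \<in> set_compose K C"
    using assms projectionI[of 0 m] by (intro set_composeI) auto
  then show ?thesis
    using assms(1) unfolding bfun_compose_const by blast
qed

section \<open>Enlarging a clonoid by the constants of another clone\<close>

lemma clonoid_Un_constants:
  assumes C1: "clone C1" and K: "clonoid C1 C2 K" and C2': "clone C2'"
    and sub: "C2' \<subseteq> C2 \<union> constants"
  shows "clonoid C1 C2' (K \<union> (C2' \<inter> constants))" (is "clonoid _ _ ?K'")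
proof -
  have K_rules: "K \<subseteq> boolean_functions" "set_compose K C1 \<subseteq> K" "set_compose C2 K \<subseteq> K"
    using K unfolding clonoid_def by auto
  have C1_rules: "C1 \<subseteq> boolean_functions" "projections \<subseteq> C1"
    using C1 unfolding clone_def by auto
  have C2'_rules: "C2' \<subseteq> boolean_functions" "projections \<subseteq> C2'" "set_compose C2' C2' \<subseteq> C2'"
    using C2' unfolding clone_def by auto
  have const_C2': "(m, \<lambda>a\<in>cube m. c) \<in> C2' \<inter> constants"
    if "(n, \<lambda>a\<in>cube n. c) \<in> C2'" "m \<ge> 1" for m n c
    using const_change_arity[OF C2'_rules(3,2) that] constantI[OF that(2)] by simp
  have "x \<in> ?K'" if "x \<in> set_compose ?K' C1" for x
    using that
  proof (rule set_composeE)
    fix m f gs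
    assume x: "x = (m, bfun_compose m f gs)" and f: "(length gs, f) \<in> ?K'"
      and gs: "\<And>g. g \<in> set gs \<Longrightarrow> (m, g) \<in> C1"
    show ?thesis
    proof (cases "(length gs, f) \<in> K")
      case True
      then show ?thesis
        using set_composeI[OF True gs] K_rules(2) x by blast
    next
      case False
      with f obtain c where c: "length gs \<ge> 1" "f = (\<lambda>a\<in>cube (length gs). c)"
          and fC: "(length gs, f) \<in> C2'"
        using constantsE by blast
      \<comment> \<open>\<open>set_compose\<close> itself puts no lower bound on \<open>m\<close>;
        an inner function supplies \<open>m \<ge> 1\<close>, without which the constant composite
        would not be a Boolean function.\<close>
      then have "hd gs \<in> set gs"
        by (intro hd_in_set) auto
      then have "m \<ge> 1"
        using gs C1_rules(1) arity_pos by blast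
      then show ?thesis
        using const_C2' fC unfolding x c(2) bfun_compose_const by blast
    qed
  qed
  moreover have "x \<in> ?K'" if "x \<in> set_compose C2' ?K'" for x
    using that
  proof (rule set_composeE)
    fix m f gs
    assume x: "x = (m, bfun_compose m f gs)" and f: "(length gs, f) \<in> C2'"
      and gs: "\<And>g. g \<in> set gs \<Longrightarrow> (m, g) \<in> ?K'"
    define n where "n = length gs"
    \<comment> \<open>A reference point at which the values of the constant inner functions are read
      off.\<close>
    define z where "z = replicate m False"
    have n: "n \<ge> 1"
      using f C2'_rules(1) arity_pos unfolding n_def by blast
    then have "hd gs \<in> set gs"
      unfolding n_def by (intro hd_in_set) auto
    then have m: "m \<ge> 1"
      using gs K_rules(1) C2'_rules(1) arity_pos by blast
    have const: "\<exists>c. g = (\<lambda>a\<in>cube m. c) \<and> (m, g) \<in> C2'" if "g \<in> set gs" "(m, g) \<notin> K" for g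
      using gs[OF that(1)] that(2) by (auto elim: constantsE)
    have const_val: "g a = g z" if "g \<in> set gs" "(m, g) \<notin> K" "a \<in> cube m" for g a
      using const[OF that(1,2)] that(3) unfolding z_def by auto
    \<comment> \<open>If no inner function lies in \<open>K\<close>, all of them are constants of
      \<open>C2'\<close>, and so is the composite. Otherwise some member of \<open>K\<close> is
      available as a filler argument.\<close>
    show ?thesis
    proof (cases "\<exists>g\<in>set gs. (m, g) \<in> K")
      case False
      have "x \<in> C2'"
        using set_composeI[of gs f C2' m C2'] f const False C2'_rules(3) x by blast
      moreover have "bfun_compose m f gs = (\<lambda>a\<in>cube m. f (map (\<lambda>g. g z) gs))"
        unfolding bfun_compose_def using const_val False
        by (intro restrict_ext arg_cong[where f = f] map_cong refl) blast
      ultimately show ?thesis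
        using constantI[OF m] x by simp
    next
      case True
      then obtain g0 where g0: "(m, g0) \<in> K" by blast
      define p where "p i = (if (m, gs ! i) \<in> K then (\<lambda>a\<in>cube n. a ! i)
                             else (\<lambda>a\<in>cube n. (gs ! i) z))" for i
      define f' where "f' = bfun_compose n f (map p [0..<n])"
      define gs' where "gs' = map (\<lambda>g. if (m, g) \<in> K then g else g0) gs"
      have len: "length gs' = n"
        unfolding gs'_def n_def by simp
      have p: "(n, p i) \<in> C2'" if i: "i < n" for i
      proof (cases "(m, gs ! i) \<in> K")
        case True
        then show ?thesis
          using projectionI[OF i] C2'_rules(2) unfolding p_def by auto
      next
        case False
        with i obtain c where "gs ! i = (\<lambda>a\<in>cube m. c)" "(m, gs ! i) \<in> C2'"
          using const[of "gs ! i"] unfolding n_def by auto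
        \<comment> \<open>The constant \<open>gs ! i\<close> has arity \<open>m\<close>, while
          \<open>p i\<close> has arity \<open>n\<close>; \<open>const_C2'\<close> bridges the
          two.\<close>
        then show ?thesis
          using False const_C2'[OF _ n, of m c] unfolding p_def z_def by auto
      qed
      have "(n, f') \<in> set_compose C2' C2'"
        unfolding f'_def using f p by (intro set_composeI) (auto simp: n_def)
      then have f': "(n, f') \<in> C2'"
        using C2'_rules(3) by blast
      have gs': "(m, g) \<in> K" if "g \<in> set gs'" for g
        using that g0 unfolding gs'_def by auto
      have eq: "bfun_compose m f gs = bfun_compose m f' gs'"
      proof -
        have "map (\<lambda>g. g a) gs = map (\<lambda>h. h (map (\<lambda>g. g a) gs')) (map p [0..<n])"
          if a: "a \<in> cube m" for a
        proof (rule nth_equalityI)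
          fix i assume "i < length (map (\<lambda>g. g a) gs)"
          then have i: "i < n" by (simp add: n_def)
          have "map (\<lambda>g. g a) gs' \<in> cube n"
            using len by (simp add: cube_def)
          then show "map (\<lambda>g. g a) gs ! i = map (\<lambda>h. h (map (\<lambda>g. g a) gs')) (map p [0..<n]) ! i"
            using i const_val[of "gs ! i" a] a by (auto simp: p_def gs'_def n_def)
        qed (simp add: n_def)
        moreover have "map (\<lambda>g. g a) gs' \<in> cube n" for a
          using len by (simp add: cube_def)
        ultimately show ?thesis
          unfolding f'_def bfun_compose_def by (intro restrict_ext) simp
      qed
      show ?thesis
      \<comment> \<open>Freezing can turn a member of \<open>C2\<close> into a constant outside
        \<open>C2\<close>, so the split is on \<open>f'\<close> and not on \<open>f\<close>. In the
        second case the composite is a constant of \<open>C2'\<close>.\<close>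
      proof (cases "(n, f') \<in> C2")
        case True
        then have "(m, bfun_compose m f' gs') \<in> set_compose C2 K"
          using gs' len by (intro set_composeI) auto
        then show ?thesis
          using K_rules(3) x eq by auto
      next
        case False
        with f' sub obtain c where c: "f' = (\<lambda>a\<in>cube n. c)"
          using constantsE by blast
        then have "bfun_compose m f' gs' = (\<lambda>a\<in>cube m. c)"
          using bfun_compose_const[of m c gs'] len by simp
        then show ?thesis
          using const_C2'[OF _ m, of n c] f' c x eq by simp
      qed
    qed
  qed
  ultimately show ?thesis
    using K_rules(1) C2'_rules(1) unfolding clonoid_def by blast
qed

section \<open>Constant parts and comparison of cardinalities\<close>

lemma clonoid_Int_constants:
  assumes "clone C1" "clonoid C1 C2 K"
  shows "K \<inter> constants = {(n, \<lambda>a\<in>cube n. c) | n c. n \<ge> 1 \<and> c \<in> {c. (1, \<lambda>a\<in>cube 1. c) \<in> K}}"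
proof -
  have "set_compose K C1 \<subseteq> K" "projections \<subseteq> C1"
    using assms unfolding clonoid_def clone_def by auto
  note change = const_change_arity[OF this]
  \<comment> \<open>Changing the arity in both directions shows that the unary constants decide
    about all others.\<close>
  have "(n, \<lambda>a\<in>cube n. c) \<in> K \<longleftrightarrow> (1, \<lambda>a\<in>cube 1. c) \<in> K" if "n \<ge> 1" for n c
    using change[of n c 1] change[of 1 c n] that by blast
  then show ?thesis
    unfolding constants_def by blast
qed

lemma finite_constant_parts:
  assumes "clone C1"
  shows "finite ((\<lambda>K. K \<inter> constants) ` clonoids C1 C2)"
proof (rule finite_subset)
  \<comment> \<open>Each constant part is indexed by a set of truth values, and there are only four
    of these.\<close>
  show "(\<lambda>K. K \<inter> constants) ` clonoids C1 C2
      \<subseteq> range (\<lambda>S. {(n, \<lambda>a\<in>cube n. c) | n c. n \<ge> 1 \<and> c \<in> S})"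
    unfolding clonoids_def using clonoid_Int_constants[OF assms] by blast
qed simp

text \<open>Only constants are added in the first component, so it determines the nonconstant
  members of \<open>K\<close>; the second component restores the constant ones.\<close>

lemma clonoids_embedding:
  assumes "clone C1" "clone C2'" "C2' \<subseteq> C2 \<union> constants"
  defines "\<phi> \<equiv> \<lambda>K. (K \<union> (C2' \<inter> constants), K \<inter> constants)"
  shows "inj_on \<phi> (clonoids C1 C2)"
    and "\<phi> ` clonoids C1 C2 \<subseteq> clonoids C1 C2' \<times> (\<lambda>K. K \<inter> constants) ` clonoids C1 C2"
proof -
  show "inj_on \<phi> (clonoids C1 C2)"
    unfolding \<phi>_def inj_on_def by blast
  show "\<phi> ` clonoids C1 C2 \<subseteq> clonoids C1 C2' \<times> (\<lambda>K. K \<inter> constants) ` clonoids C1 C2"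
    using clonoid_Un_constants[OF assms(1) _ assms(2,3)] unfolding \<phi>_def clonoids_def by auto
qed

lemma finite_clonoids_transfer:
  assumes "clone C1" "clone C2'" "C2' \<subseteq> C2 \<union> constants" "finite (clonoids C1 C2')"
  shows "finite (clonoids C1 C2)"
  using inj_on_finite[OF clonoids_embedding[OF assms(1-3)]]
    finite_cartesian_product[OF assms(4) finite_constant_parts[OF assms(1)]]
  by blast

lemma countable_clonoids_transfer:
  assumes "clone C1" "clone C2'" "C2' \<subseteq> C2 \<union> constants" "countable (clonoids C1 C2')"
  shows "countable (clonoids C1 C2)"
proof (rule countable_image_inj_on[OF _ clonoids_embedding(1)[OF assms(1-3)]])
  show "countable ((\<lambda>K. (K \<union> (C2' \<inter> constants), K \<inter> constants)) ` clonoids C1 C2)"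
    using clonoids_embedding(2)[OF assms(1-3)]
    by (rule countable_subset)
      (intro countable_SIGMA assms countable_finite finite_constant_parts)
qed

section \<open>Monotone clones and their constants\<close>

lemma clone_M: "clone M_clone"
proof -
  have "x \<in> M_clone" if "x \<in> projections" for x
  proof -
    from that obtain n i where x: "x = (n, \<lambda>a\<in>cube n. a ! i)" and i: "i < n"
      unfolding projections_def by blast
    then show ?thesis
      unfolding M_clone_def boolean_functions_def by (auto simp: cube_def list_all2_conv_all_nth)
  qed
  moreover have "x \<in> M_clone" if "x \<in> set_compose M_clone M_clone" for x
    using that
  proof (rule set_composeE)
    fix m f gs
    assume x: "x = (m, bfun_compose m f gs)" and f: "(length gs, f) \<in> M_clone"
      and gs: "\<And>g. g \<in> set gs \<Longrightarrow> (m, g) \<in> M_clone"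
    from f have "length gs \<ge> 1"
      using arity_pos unfolding M_clone_def by blast
    then have "hd gs \<in> set gs"
      by (intro hd_in_set) auto
    then have m: "m \<ge> 1"
      using gs arity_pos unfolding M_clone_def by blast
    have "f (map (\<lambda>g. g a) gs) \<le> f (map (\<lambda>g. g b) gs)"
      if "a \<in> cube m" "b \<in> cube m" "list_all2 (\<le>) a b" for a b
    proof -
      have "list_all2 (\<le>) (map (\<lambda>g. g a) gs) (map (\<lambda>g. g b) gs)"
        unfolding list_all2_map1 list_all2_map2 list_all2_same
        using gs that unfolding M_clone_def by blast
      moreover have "map (\<lambda>g. g a) gs \<in> cube (length gs)" "map (\<lambda>g. g b) gs \<in> cube (length gs)"
        by simp_all
      ultimately show ?thesis
        using f unfolding M_clone_def by blast
    qed
    then show ?thesis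
      using m unfolding x M_clone_def boolean_functions_def bfun_compose_def by auto
  qed
  ultimately show ?thesis
    unfolding clone_def M_clone_def by blast
qed

lemma constants_subset_M: "constants \<subseteq> M_clone"
  unfolding constants_def M_clone_def boolean_functions_def by auto

lemma V_subset_M: "V_clone \<subseteq> M_clone"
proof -
  have "(2, \<lambda>a\<in>cube 2. a ! 0 \<or> a ! 1) \<in> M_clone"
    unfolding M_clone_def boolean_functions_def by (auto simp: cube_def list_all2_conv_all_nth)
  \<comment> \<open>\<open>V_clone\<close> is an intersection of clones, and \<open>M_clone\<close>
    is one of those intersected.\<close>
  then show ?thesis
    using clone_M constants_subset_M unfolding V_clone_def generated_clone_def by blast
qed

lemma Lambda_subset_M: "Lambda_clone \<subseteq> M_clone"
proof -
  have "(2, \<lambda>a\<in>cube 2. a ! 0 \<and> a ! 1) \<in> M_clone"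
    unfolding M_clone_def boolean_functions_def by (auto simp: cube_def list_all2_conv_all_nth)
  then show ?thesis
    using clone_M constants_subset_M unfolding Lambda_clone_def generated_clone_def by blast
qed

lemma MU_subset_M: "MU_clone k \<subseteq> M_clone"
  unfolding MU_clone_def by simp

lemma MW_subset_M: "MW_clone k \<subseteq> M_clone"
  unfolding MW_clone_def by simp

text \<open>A monotone function takes values between those at the all-0 and all-1 tuples. If it is 1
  at the former or 0 at the latter, it is therefore constant.\<close>

lemma monotone_const_preserving_or_constant:
  assumes "K \<subseteq> M_clone"
  shows "K \<subseteq> const_preserving K \<union> constants"
proof
  fix x assume x: "x \<in> K"
  obtain n f where nf: "x = (n, f)" by (cases x)
  with x assms have f: "(n, f) \<in> boolean_functions"
    and mono: "\<And>a b. a \<in> cube n \<Longrightarrow> b \<in> cube n \<Longrightarrow> list_all2 (\<le>) a b \<Longrightarrow> f a \<le> f b"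
    unfolding M_clone_def by auto
  from f have n: "n \<ge> 1" and ext: "f = (\<lambda>a\<in>cube n. f a)"
    unfolding boolean_functions_def by (auto simp: PiE_restrict)
  have low: "f (replicate n False) \<le> f a" and high: "f a \<le> f (replicate n True)"
    if "a \<in> cube n" for a
    using that by (intro mono; auto simp: cube_def list_all2_conv_all_nth)+
  have "x \<in> constants" if "f (replicate n False) \<or> \<not> f (replicate n True)"
  proof -
    \<comment> \<open>The value at the all-0 tuple serves both cases: if \<open>f\<close> is 0 at
      the all-1 tuple, it is 0 there too.\<close>
    have "(\<lambda>a\<in>cube n. f a) = (\<lambda>a\<in>cube n. f (replicate n False))"
      using low high that by (intro restrict_ext) (metis le_boolE replicate_in_cube)
    then show ?thesis
      using constantI[OF n, of "f (replicate n False)"] nf ext by metis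
  qed
  then show "x \<in> const_preserving K \<union> constants"
    using x nf unfolding const_preserving_def by auto
qed

section \<open>The intervals and the final comparison\<close>

lemma interval_differ_by_constants:
  assumes "{C2, C2'} \<subseteq> clone_interval B T" "T \<subseteq> B \<union> constants"
  shows "C2' \<subseteq> C2 \<union> constants \<and> C2 \<subseteq> C2' \<union> constants"
proof -
  have "B \<subseteq> C2" "C2 \<subseteq> T" "B \<subseteq> C2'" "C2' \<subseteq> T"
    using assms(1) unfolding clone_interval_def by auto
  then show ?thesis
    using assms(2) by (auto dest: subsetD)
qed

theorem corollary3p3:
  fixes C1 C2 C2' :: "bfun set"
  assumes "clone C1" and "clone C2" and "clone C2'"
    and "{C2, C2'} \<subseteq> clone_interval J_clone I_clone
       \<or> {C2, C2'} \<subseteq> clone_interval Istar_clone Omega1_clone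
       \<or> {C2, C2'} \<subseteq> clone_interval (const_preserving V_clone) V_clone
       \<or> {C2, C2'} \<subseteq> clone_interval (const_preserving Lambda_clone) Lambda_clone
       \<or> (\<exists>k::enat. k \<ge> 2 \<and> {C2, C2'} \<subseteq> clone_interval (const_preserving (MU_clone k)) (MU_clone k))
       \<or> (\<exists>k::enat. k \<ge> 2 \<and> {C2, C2'} \<subseteq> clone_interval (const_preserving (MW_clone k)) (MW_clone k))
       \<or> {C2, C2'} \<subseteq> clone_interval (const_preserving M_clone) M_clone"
  shows "(finite (clonoids C1 C2) \<and> finite (clonoids C1 C2'))
       \<or> (countable (clonoids C1 C2) \<and> infinite (clonoids C1 C2)
           \<and> countable (clonoids C1 C2') \<and> infinite (clonoids C1 C2'))
       \<or> (uncountable (clonoids C1 C2) \<and> uncountable (clonoids C1 C2'))"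
proof -
  have diff: "C2' \<subseteq> C2 \<union> constants \<and> C2 \<subseteq> C2' \<union> constants"
  proof -
    have "I_clone \<subseteq> J_clone \<union> constants"
        "Omega1_clone \<subseteq> Istar_clone \<union> constants"
      unfolding I_clone_def J_clone_def Omega1_clone_def Istar_clone_def by auto
    \<comment> \<open>One inclusion of the top in the bottom plus constants for each interval; the
      last takes \<open>K\<close> to be \<open>M_clone\<close> itself.\<close>
    note tops = this V_subset_M[THEN monotone_const_preserving_or_constant]
      Lambda_subset_M[THEN monotone_const_preserving_or_constant]
      MU_subset_M[THEN monotone_const_preserving_or_constant]
      MW_subset_M[THEN monotone_const_preserving_or_constant]
      order_refl[THEN monotone_const_preserving_or_constant]
    from assms(4) show ?thesis
      by (elim disjE exE conjE tops[THEN interval_differ_by_constants[rotated]])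
  qed
  \<comment> \<open>Since \<open>diff\<close> is symmetric, the transfer lemmas apply in both
    directions.\<close>
  have "finite (clonoids C1 C2) \<longleftrightarrow> finite (clonoids C1 C2')"
    using finite_clonoids_transfer[OF assms(1)] assms(2,3) diff by metis
  moreover have "countable (clonoids C1 C2) \<longleftrightarrow> countable (clonoids C1 C2')"
    using countable_clonoids_transfer[OF assms(1)] assms(2,3) diff by metis
  ultimately show ?thesis
    by blast
qed

end
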